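(* Let $R$ be a commutative semiring, $S\subsetneq R$ a multiplicative subset, and $A$ an $S$-primary ideal of $R$. Then the $S$-radical $\sqrt[S]{A}$ is a prime ideal of $R$.
   Context: Semirings have unity $1$ and zero $0$. A multiplicative subset of $R$ is a nonempty subset $S\subsetneq R$ with $1\in S$ and $s_1s_2\in S$ for all $s_1,s_2\in S$. The radical of an ideal $I$ is $\sqrt I=\{x\in R: x^n\in I \text{ for some } n\in\mathbb N\}$, $n\geq 1$. An ideal $A$ with $A\cap S=\varnothing$ is $S$-primary if there exists $s\in S$ such that for all $a,b\in R$, $ab\in A$ implies $sa\in A$ or $sb\in\sqrt A$. The $S$-radical of an ideal $I$ is $\sqrt[S]{I}=\{a\in R: sa^n\in I \text{ for some } s\in S \text{ and } n\in\mathbb N\}$, $n\geq 1$. A prime ideal is a proper ideal $P$ such that $ab\in P$ implies $a\in P$ or $b\in P$. *)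

theory Defs
  imports Main
begin

text \<open>
  The semiring is the carrier of a type of class \<open>comm_semiring_1\<close>. This class contains the
  axiom \<open>0 \<noteq> 1\<close>, which is no restriction in the presence of a multiplicative subset: such a
  subset is proper and contains \<open>1\<close>, so the zero semiring has none.
\<close>

definition multiplicative_subset :: "'a::comm_semiring_1 set \<Rightarrow> bool" where
  "multiplicative_subset S \<longleftrightarrow> S \<subset> UNIV \<and> 1 \<in> S \<and> (\<forall>s\<in>S. \<forall>t\<in>S. s * t \<in> S)"

text \<open>
  Ideals of a semiring are not required to be proper; \<open>0 \<in> I\<close> follows from nonemptiness and
  absorption. There is no closure under subtraction.
\<close>

definition semiring_ideal :: "'a::comm_semiring_1 set \<Rightarrow> bool" where
  "semiring_ideal I \<longleftrightarrow>
     I \<noteq> {} \<and> (\<forall>a\<in>I. \<forall>b\<in>I. a + b \<in> I) \<and> (\<forall>r. \<forall>a\<in>I. r * a \<in> I)"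

definition prime_semiring_ideal :: "'a::comm_semiring_1 set \<Rightarrow> bool" where
  "prime_semiring_ideal P \<longleftrightarrow>
     semiring_ideal P \<and> P \<noteq> UNIV \<and> (\<forall>a b. a * b \<in> P \<longrightarrow> a \<in> P \<or> b \<in> P)"

definition ideal_radical :: "'a::comm_semiring_1 set \<Rightarrow> 'a set" where
  "ideal_radical I = {x. \<exists>n::nat. n \<ge> 1 \<and> x ^ n \<in> I}"

definition S_radical :: "'a::comm_semiring_1 set \<Rightarrow> 'a set \<Rightarrow> 'a set" where
  "S_radical S I = {a. \<exists>s\<in>S. \<exists>n::nat. n \<ge> 1 \<and> s * a ^ n \<in> I}"

definition S_primary :: "'a::comm_semiring_1 set \<Rightarrow> 'a set \<Rightarrow> bool" where
  "S_primary S A \<longleftrightarrow>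
     semiring_ideal A \<and> A \<inter> S = {} \<and>
     (\<exists>s\<in>S. \<forall>a b. a * b \<in> A \<longrightarrow> s * a \<in> A \<or> s * b \<in> ideal_radical A)"

end

theory Submission
  imports Defs
begin

text \<open>Membership in the S-radical is membership in \<open>A\<close> up to a power and a factor
  from \<open>S\<close>, and both can be absorbed. If \<open>t * (a * b) ^ n\<close> lies in
  \<open>A\<close>, regroup it as \<open>(t * a ^ n) * b ^ n\<close> and apply the S-primary
  condition with its witness \<open>s\<close>. Either \<open>(s * t) * a ^ n\<close> lies in
  \<open>A\<close>, or some power \<open>(s * b ^ n) ^ k = s ^ k * b ^ (n * k)\<close> does; since
  \<open>S\<close> is closed under products and powers, \<open>a\<close> or \<open>b\<close> is in
  the S-radical. Properness comes from the disjointness of \<open>A\<close> and \<open>S\<close>.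
  That the S-radical is an ideal at all, \<open>semiring_ideal_S_radical\<close>, holds for every
  ideal and rests on the binomial theorem, which is available without subtraction.\<close>

lemma multiplicative_subset_power:
  assumes "multiplicative_subset S" "s \<in> S"
  shows "s ^ n \<in> S"
  using assms by (induction n) (auto simp: multiplicative_subset_def)

lemma semiring_ideal_zero:
  assumes "semiring_ideal I"
  shows "0 \<in> I"
proof -
  obtain a where "a \<in> I"
    using assms by (auto simp: semiring_ideal_def)
  then have "0 * a \<in> I"
    using assms unfolding semiring_ideal_def by blast
  then show ?thesis by simp
qed

lemma semiring_ideal_add:
  "semiring_ideal I \<Longrightarrow> a \<in> I \<Longrightarrow> b \<in> I \<Longrightarrow> a + b \<in> I"
  by (simp add: semiring_ideal_def)

lemma semiring_ideal_mult_left: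
  "semiring_ideal I \<Longrightarrow> a \<in> I \<Longrightarrow> r * a \<in> I"
  by (simp add: semiring_ideal_def)

lemma semiring_ideal_sum:
  assumes "semiring_ideal I" "\<And>x. x \<in> X \<Longrightarrow> f x \<in> I"
  shows "sum f X \<in> I"
  using assms(2)
  by (induction X rule: infinite_finite_induct)
     (auto intro: semiring_ideal_zero semiring_ideal_add assms(1))

text \<open>As for the ordinary radical, sums are handled by a binomial expansion; multiplying the
  two factors from \<open>S\<close> together gives one factor that serves every term.\<close>

lemma semiring_ideal_S_radical:
  assumes S: "multiplicative_subset S" and I: "semiring_ideal I"
  shows "semiring_ideal (S_radical S I)"
proof -
  have "0 \<in> S_radical S I"
    using S semiring_ideal_zero[OF I]
    by (auto simp: S_radical_def multiplicative_subset_def intro!: bexI[of _ 1] exI[of _ 1])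
  moreover have "a + b \<in> S_radical S I" if "a \<in> S_radical S I" "b \<in> S_radical S I" for a b
  proof -
    obtain s n where s: "s \<in> S" "n \<ge> 1" "s * a ^ n \<in> I"
      using \<open>a \<in> S_radical S I\<close> by (auto simp: S_radical_def)
    obtain t m where t: "t \<in> S" "m \<ge> 1" "t * b ^ m \<in> I"
      using \<open>b \<in> S_radical S I\<close> by (auto simp: S_radical_def)
    \<comment> \<open>With exponent \<open>n + m\<close>, each binomial term contains
      \<open>a ^ n\<close> or \<open>b ^ m\<close>, so it is a multiple of \<open>s * a ^ n\<close>
      or of \<open>t * b ^ m\<close>.\<close>
    have "s * t * (of_nat (n + m choose k) * a ^ k * b ^ (n + m - k)) \<in> I" if "k \<le> n + m" for k
    proof (cases "n \<le> k")
      case True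
      then have "a ^ k = a ^ n * a ^ (k - n)"
        by (simp flip: power_add)
      then have "s * t * (of_nat (n + m choose k) * a ^ k * b ^ (n + m - k)) =
          (t * of_nat (n + m choose k) * a ^ (k - n) * b ^ (n + m - k)) * (s * a ^ n)"
        by (simp add: mult_ac)
      then show ?thesis
        using semiring_ideal_mult_left[OF I s(3)] by simp
    next
      case False
      \<comment> \<open>Here \<open>k < n\<close>, so the truncated difference \<open>n - k\<close>
        is genuine and \<open>n + m - k = m + (n - k)\<close>.\<close>
      then have "b ^ (n + m - k) = b ^ m * b ^ (n - k)"
        by (simp add: add.commute flip: power_add)
      then have "s * t * (of_nat (n + m choose k) * a ^ k * b ^ (n + m - k)) =
          (s * of_nat (n + m choose k) * a ^ k * b ^ (n - k)) * (t * b ^ m)"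
        by (simp add: mult_ac)
      then show ?thesis
        using semiring_ideal_mult_left[OF I t(3)] by simp
    qed
    then have "s * t * (a + b) ^ (n + m) \<in> I"
      unfolding binomial_ring sum_distrib_left by (intro semiring_ideal_sum I) simp
    moreover have "s * t \<in> S"
      using S s(1) t(1) by (simp add: multiplicative_subset_def)
    moreover have "n + m \<ge> 1"
      using s(2) by simp
    ultimately show ?thesis
      unfolding S_radical_def by blast
  qed
  moreover have "r * a \<in> S_radical S I" if "a \<in> S_radical S I" for r a
  proof -
    obtain s n where s: "s \<in> S" "n \<ge> 1" "s * a ^ n \<in> I"
      using \<open>a \<in> S_radical S I\<close> by (auto simp: S_radical_def)
    have "s * (r * a) ^ n = r ^ n * (s * a ^ n)"
      by (simp add: power_mult_distrib mult_ac)
    then have "s * (r * a) ^ n \<in> I"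
      using semiring_ideal_mult_left[OF I s(3)] by simp
    then show ?thesis
      using s(1,2) unfolding S_radical_def by blast
  qed
  ultimately show ?thesis
    unfolding semiring_ideal_def by blast
qed

theorem theorem2p4:
  fixes S A :: "'a::comm_semiring_1 set"
  assumes "multiplicative_subset S"
    and "S_primary S A"
  shows "prime_semiring_ideal (S_radical S A)"
proof -
  have A: "semiring_ideal A" and disj: "A \<inter> S = {}"
    using assms(2) by (auto simp: S_primary_def)
  obtain s where s: "s \<in> S"
    and primary: "\<And>a b. a * b \<in> A \<Longrightarrow> s * a \<in> A \<or> s * b \<in> ideal_radical A"
    using assms(2) by (auto simp: S_primary_def)
  \<comment> \<open>All powers of 1 are 1, so membership would put some element of \<open>S\<close>
    itself into \<open>A\<close>.\<close>
  have "1 \<notin> S_radical S A"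
    using disj by (auto simp: S_radical_def)
  then have proper: "S_radical S A \<noteq> UNIV"
    by blast
  have prime: "a \<in> S_radical S A \<or> b \<in> S_radical S A" if "a * b \<in> S_radical S A" for a b
  proof -
    obtain t n where t: "t \<in> S" "n \<ge> 1" "t * (a * b) ^ n \<in> A"
      using \<open>a * b \<in> S_radical S A\<close> by (auto simp: S_radical_def)
    \<comment> \<open>Attaching \<open>t\<close> to the first factor keeps the second a pure power
      of \<open>b\<close>, so in the radical case the only factor from \<open>S\<close> is a power
      of \<open>s\<close>.\<close>
    have "(t * a ^ n) * b ^ n \<in> A"
      using t(3) by (simp add: power_mult_distrib mult_ac)
    then consider "s * (t * a ^ n) \<in> A" | "s * b ^ n \<in> ideal_radical A"
      using primary by blast
    then show ?thesis
    proof cases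
      case 1
      then have "(s * t) * a ^ n \<in> A"
        by (simp add: mult_ac)
      moreover have "s * t \<in> S"
        using assms(1) s t(1) by (simp add: multiplicative_subset_def)
      ultimately show ?thesis
        using t(2) unfolding S_radical_def by blast
    next
      case 2
      then obtain k where k: "k \<ge> 1" "(s * b ^ n) ^ k \<in> A"
        by (auto simp: ideal_radical_def)
      have "s ^ k * b ^ (n * k) \<in> A"
        using k(2) by (simp add: power_mult_distrib power_mult)
      moreover have "s ^ k \<in> S"
        using multiplicative_subset_power[OF assms(1) s] .
      moreover have "n * k \<ge> 1"
        using k(1) t(2) by simp
      ultimately show ?thesis
        unfolding S_radical_def by blast
    qed
  qed
  show ?thesis
    unfolding prime_semiring_ideal_def
    using semiring_ideal_S_radical[OF assms(1) A] proper prime by blast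
qed

end
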